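(* Consider Perturbed GDA run with constant parameters $r_y>0$, $\alpha$, $c$ satisfying $$\alpha=\Theta\Big(\tfrac1\ell\Big),\quad 0<\alpha\le\frac{1}{4(\ell+r_y)},\qquad c=\Theta\Big(\tfrac{r_y^2}{\ell^3}\Big),\quad 0<c\le\min\Big\{\frac{r_y^2\alpha}{16\ell^2},\frac{r_y}{\ell(3r_y+2\ell)},\frac{3r_y}{128\ell^2}\Big\},$$ where the perturbation parameter is $r_y=\Theta(\epsilon/D_{\mathcal Y})$ in item (i) and $r_y=\Theta(\epsilon^2/(\ell D_{\mathcal Y}^2))$ in item (ii). Let $(x^T,y^T)$ be the output after $T$ iterations. Then there exist an $\ell$-smooth function $f$ (with domains $\mathcal X,\mathcal Y$, satisfying the assumptions in the context) and an initialization $(x^0,y^0)$ for which both of the following hold: (i) (Game stationarity) Perturbed GDA requires at least $T=\Omega\big(\ell^3D_{\mathcal Y}^2\Delta_{\Psi_1}/\epsilon^4\big)$ iterations to guarantee that $(x^T,y^T)$ is an $\epsilon$-GS of $\min_{x\in\mathcal X}\max_{y\in\mathcal Y}f(x,y)$. (ii) (Optimization stationarity) Perturbed GDA requires at least $T=\Omega\big(\ell^5D_{\mathcal Y}^4\Delta_{\Psi_1}/\epsilon^6\big)$ iterations to guarantee that $x^T$ is an $\epsilon$-OS of $\min_{x\in\mathcal X}\max_{y\in\mathcal Y}f(x,y)$.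
   Context: Setting: $f:\mathbb R^n\times\mathbb R^d\to\mathbb R$; $\mathcal X\subseteq\mathbb R^n$ is nonempty, closed and convex; $\mathcal Y\subseteq\mathbb R^d$ is nonempty, compact and convex with $0\in\mathcal Y$ and diameter $D_{\mathcal Y}>0$. The function $f$ is continuously differentiable and $\ell$-smooth ($\ell>0$): for all $x,x'\in\mathcal X$, $y,y'\in\mathcal Y$, both $\|\nabla_xf(x,y)-\nabla_xf(x',y')\|$ and $\|\nabla_yf(x,y)-\nabla_yf(x',y')\|$ are at most $\ell(\|x-x'\|+\|y-y'\|)$. For each $x\in\mathcal X$, $f(x,\cdot)$ is concave. Stationarity: $\iota_S$ is the indicator function of a set $S$ ($0$ on $S$, $+\infty$ outside), and $\partial\iota_S$ its subdifferential. A pair $(x,y)\in\mathcal X\times\mathcal Y$ is an $\epsilon$-game-stationary point ($\epsilon$-GS) if $\mathrm{dist}(0,\nabla_xf(x,y)+\partial\iota_{\mathcal X}(x))\le\epsilon$ and $\mathrm{dist}(0,-\nabla_yf(x,y)+\partial\iota_{\mathcal Y}(y))\le\epsilon$. Let $\Phi(x)=\max_{y'\in\mathcal Y}f(x,y')+\iota_{\mathcal X}(x)$. A point $x\in\mathcal X$ is an $\epsilon$-optimization-stationary point ($\epsilon$-OS) if $\|\mathrm{prox}_{\frac{1}{2\ell}\Phi}(x)-x\|\le\frac{\epsilon}{2\ell}$, where $\mathrm{prox}_{\frac1{2\ell}\Phi}(x)=\arg\min_{w}\{\Phi(w)+\ell\|w-x\|^2\}$. Perturbed GDA (constant parameters):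 let $f_0(x,y)=f(x,y)-\frac{r_y}{2}\|y\|^2$. From $(x^0,y^0)$, iterate $$x^{t+1}=\mathrm{proj}_{\mathcal X}(x^t-c\nabla_xf_0(x^t,y^t)),\qquad y^{t+1}=\mathrm{proj}_{\mathcal Y}(y^t+\alpha\nabla_yf_0(x^{t+1},y^t)).$$ Initial gap: $\Delta_{\Psi_1}=\Psi_1^0(x^0,y^0)-\min_{x\in\mathcal X}\max_{y\in\mathcal Y}f_0(x,y)$, where $\Psi_1^0(x,y)=2\max_{y'\in\mathcal Y}f_0(x,y')-f_0(x,y)$ (with the $r_y$ of the item concerned). Conventions: $\epsilon\in(0,1)$ is a sufficiently small positive number. "Requires at least $T=\Omega(\cdot)$ iterations" means that any $T$ for which the $T$-th iterate has the stated stationarity property satisfies $T=\Omega(\cdot)$. $\Omega$ and $\Theta$ hide positive constants not depending on $\epsilon,\ell,D_{\mathcal Y},\Delta_{\Psi_1},T$. *)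

theory Defs
  imports "HOL-Analysis.Analysis"
begin

section \<open>Gradients\<close>

definition grad :: "('a::real_inner \<Rightarrow> real) \<Rightarrow> 'a \<Rightarrow> 'a" where
  "grad F x = (THE g. GDERIV F x :> g)"

definition grad_x :: "('a::real_inner \<Rightarrow> 'b \<Rightarrow> real) \<Rightarrow> 'a \<Rightarrow> 'b \<Rightarrow> 'a" where
  "grad_x f x y = grad (\<lambda>u. f u y) x"

definition grad_y :: "('a \<Rightarrow> 'b::real_inner \<Rightarrow> real) \<Rightarrow> 'a \<Rightarrow> 'b \<Rightarrow> 'b" where
  "grad_y f x y = grad (\<lambda>v. f x v) y"

section \<open>Minimax problems\<close>

definition continuously_differentiable ::
    "('a::real_normed_vector \<Rightarrow> 'b::real_normed_vector \<Rightarrow> real) \<Rightarrow> bool" where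
  "continuously_differentiable f \<longleftrightarrow>
     (\<exists>f' :: 'a \<times> 'b \<Rightarrow> ('a \<times> 'b) \<Rightarrow>\<^sub>L real.
        (\<forall>p. ((\<lambda>(x, y). f x y) has_derivative blinfun_apply (f' p)) (at p)) \<and>
        continuous_on UNIV f')"

definition smooth_on_domain ::
    "real \<Rightarrow> ('a::real_inner \<Rightarrow> 'b::real_inner \<Rightarrow> real) \<Rightarrow> 'a set \<Rightarrow> 'b set \<Rightarrow> bool" where
  "smooth_on_domain l f X Y \<longleftrightarrow>
     (\<forall>x\<in>X. \<forall>x'\<in>X. \<forall>y\<in>Y. \<forall>y'\<in>Y.
        norm (grad_x f x y - grad_x f x' y') \<le> l * (norm (x - x') + norm (y - y')) \<and>
        norm (grad_y f x y - grad_y f x' y') \<le> l * (norm (x - x') + norm (y - y')))"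

definition minimax_problem ::
    "real \<Rightarrow> ('a::euclidean_space \<Rightarrow> 'b::euclidean_space \<Rightarrow> real) \<Rightarrow> 'a set \<Rightarrow> 'b set \<Rightarrow> bool" where
  "minimax_problem l f X Y \<longleftrightarrow>
     X \<noteq> {} \<and> closed X \<and> convex X \<and>
     Y \<noteq> {} \<and> compact Y \<and> convex Y \<and> 0 \<in> Y \<and> diameter Y > 0 \<and>
     continuously_differentiable f \<and> smooth_on_domain l f X Y \<and>
     (\<forall>x\<in>X. concave_on Y (f x))"

section \<open>Stationarity\<close>

definition ind_fun :: "'a set \<Rightarrow> 'a \<Rightarrow> ereal" where
  "ind_fun S x = (if x \<in> S then 0 else \<infinity>)"

text \<open>The subdifferential of convex analysis; it is empty outside the effective domain.\<close>

definition subdifferential :: "('a::real_inner \<Rightarrow> ereal) \<Rightarrow> 'a \<Rightarrow> 'a set" where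
  "subdifferential \<phi> x =
     {v. \<bar>\<phi> x\<bar> \<noteq> \<infinity> \<and> (\<forall>z. \<phi> x + ereal (v \<bullet> (z - x)) \<le> \<phi> z)}"

definition game_stationary ::
    "real \<Rightarrow> ('a::euclidean_space \<Rightarrow> 'b::euclidean_space \<Rightarrow> real) \<Rightarrow> 'a set \<Rightarrow> 'b set \<Rightarrow>
      'a \<Rightarrow> 'b \<Rightarrow> bool" where
  "game_stationary \<epsilon> f X Y x y \<longleftrightarrow>
     x \<in> X \<and> y \<in> Y \<and>
     infdist 0 ((\<lambda>v. grad_x f x y + v) ` subdifferential (ind_fun X) x) \<le> \<epsilon> \<and>
     infdist 0 ((\<lambda>v. - grad_y f x y + v) ` subdifferential (ind_fun Y) y) \<le> \<epsilon>"

text \<open>For compact \<open>Y\<close> and continuous \<open>f x\<close> the supremum below is a maximum.\<close>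

definition max_fun :: "('a \<Rightarrow> 'b \<Rightarrow> real) \<Rightarrow> 'b set \<Rightarrow> 'a \<Rightarrow> real" where
  "max_fun f Y x = (SUP y\<in>Y. f x y)"

definition Phi :: "('a \<Rightarrow> 'b \<Rightarrow> real) \<Rightarrow> 'a set \<Rightarrow> 'b set \<Rightarrow> 'a \<Rightarrow> ereal" where
  "Phi f X Y x = ereal (max_fun f Y x) + ind_fun X x"

text \<open>
  The proximal map with parameter \<open>\<mu>\<close>; for \<open>\<mu> = 1 / (2 * l)\<close> the quadratic
  term is \<open>l * (norm (w - x))\<^sup>2\<close>.  For an \<open>l\<close>-smooth problem \<open>Phi\<close> is \<open>l\<close>-weakly
  convex, so with this parameter the minimiser exists and is unique.
\<close>

definition prox :: "real \<Rightarrow> ('a::euclidean_space \<Rightarrow> ereal) \<Rightarrow> 'a \<Rightarrow> 'a" where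
  "prox \<mu> \<phi> x = (ARG_MIN (\<lambda>w. \<phi> w + ereal (1 / (2 * \<mu>) * (norm (w - x))\<^sup>2)) w. True)"

definition optimization_stationary ::
    "real \<Rightarrow> real \<Rightarrow> ('a::euclidean_space \<Rightarrow> 'b \<Rightarrow> real) \<Rightarrow> 'a set \<Rightarrow> 'b set \<Rightarrow> 'a \<Rightarrow> bool" where
  "optimization_stationary l \<epsilon> f X Y x \<longleftrightarrow>
     x \<in> X \<and> norm (prox (1 / (2 * l)) (Phi f X Y) x - x) \<le> \<epsilon> / (2 * l)"

section \<open>Perturbed gradient descent ascent\<close>

definition perturbed :: "real \<Rightarrow> ('a \<Rightarrow> 'b::real_normed_vector \<Rightarrow> real) \<Rightarrow> 'a \<Rightarrow> 'b \<Rightarrow> real" where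
  "perturbed r f x y = f x y - r / 2 * (norm y)\<^sup>2"

text \<open>\<open>closest_point S\<close> is the projection onto the nonempty closed convex set \<open>S\<close>.\<close>

primrec perturbed_gda ::
    "real \<Rightarrow> real \<Rightarrow> real \<Rightarrow> ('a::euclidean_space \<Rightarrow> 'b::euclidean_space \<Rightarrow> real) \<Rightarrow>
      'a set \<Rightarrow> 'b set \<Rightarrow> 'a \<Rightarrow> 'b \<Rightarrow> nat \<Rightarrow> 'a \<times> 'b" where
  "perturbed_gda r \<alpha> c f X Y x0 y0 0 = (x0, y0)"
| "perturbed_gda r \<alpha> c f X Y x0 y0 (Suc t) =
     (let (x, y) = perturbed_gda r \<alpha> c f X Y x0 y0 t;
          x' = closest_point X (x - c *\<^sub>R grad_x (perturbed r f) x y);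
          y' = closest_point Y (y + \<alpha> *\<^sub>R grad_y (perturbed r f) x' y)
      in (x', y'))"

definition Psi :: "real \<Rightarrow> ('a \<Rightarrow> 'b::real_normed_vector \<Rightarrow> real) \<Rightarrow> 'b set \<Rightarrow> 'a \<Rightarrow> 'b \<Rightarrow> real" where
  "Psi r f Y x y = 2 * max_fun (perturbed r f) Y x - perturbed r f x y"

text \<open>
  The relation form records that the minimum over \<open>X\<close> in
  \<open>\<Delta> = Psi r f Y x0 y0 - (min over x in X of max over y in Y of perturbed r f x y)\<close>
  is attained, so that no junk value of \<open>Inf\<close> enters.
\<close>

definition has_initial_gap ::
    "real \<Rightarrow> ('a \<Rightarrow> 'b::real_normed_vector \<Rightarrow> real) \<Rightarrow> 'a set \<Rightarrow> 'b set \<Rightarrow>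
      'a \<Rightarrow> 'b \<Rightarrow> real \<Rightarrow> bool" where
  "has_initial_gap r f X Y x0 y0 \<Delta> \<longleftrightarrow>
     (\<exists>x\<in>X. (\<forall>z\<in>X. max_fun (perturbed r f) Y x \<le> max_fun (perturbed r f) Y z) \<and>
        \<Delta> = Psi r f Y x0 y0 - max_fun (perturbed r f) Y x)"

section \<open>Parameter regimes\<close>

text \<open>\<open>u = \<Theta>(v)\<close> with explicit lower and upper constants \<open>a\<close> and \<open>b\<close>.\<close>

definition theta_rel :: "real \<Rightarrow> real \<Rightarrow> real \<Rightarrow> real \<Rightarrow> bool" where
  "theta_rel a b u v \<longleftrightarrow> a * v \<le> u \<and> u \<le> b * v"

definition gda_parameters ::
    "real \<Rightarrow> real \<Rightarrow> real \<Rightarrow> real \<Rightarrow> real \<Rightarrow> real \<Rightarrow> bool" where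
  "gda_parameters a b l r \<alpha> c \<longleftrightarrow>
     r > 0 \<and>
     theta_rel a b \<alpha> (1 / l) \<and> 0 < \<alpha> \<and> \<alpha> \<le> 1 / (4 * (l + r)) \<and>
     theta_rel a b c (r\<^sup>2 / l ^ 3) \<and> 0 < c \<and>
     c \<le> Min {r\<^sup>2 * \<alpha> / (16 * l\<^sup>2), r / (l * (3 * r + 2 * l)), 3 * r / (128 * l\<^sup>2)}"

end

theory Submission
  imports Defs
begin

text \<open>
  The hard instance is the linear function \<open>f x y = g \<bullet> x\<close> with \<open>norm g = 2 * \<epsilon>\<close> on the
  half-space \<open>{x. 0 \<le> g \<bullet> x}\<close>.  Neither kind of stationarity can occur before the iterates come
  close to the boundary, where the objective has dropped by at least \<open>\<Delta> / 2\<close>, whereas one step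
  lowers the objective by at most \<open>c * (norm g)\<^sup>2 = 4 * c * \<epsilon>\<^sup>2\<close>.  Hence \<open>T \<ge> \<Delta> / (8 * c * \<epsilon>\<^sup>2)\<close>, and
  \<open>c \<le> b * r\<^sup>2 / l ^ 3\<close> turns this into both rates.
\<close>

section \<open>Gradients of the linear objective\<close>

lemma grad_eqI:
  assumes "GDERIV F x :> g"
  shows "grad F x = g"
  unfolding grad_def
proof (rule the_equality)
  show "GDERIV F x :> g" by fact
  fix h assume "GDERIV F x :> h"
  then have "(\<lambda>v. v \<bullet> h) = (\<lambda>v. v \<bullet> g)"
    using assms unfolding gderiv_def by (rule has_derivative_unique)
  then show "h = g"
    using vector_eq_ldot[of h g] by (simp add: fun_eq_iff)
qed

text \<open>The constant \<open>k\<close> stands for the perturbation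
  \<open>r / 2 * (norm y)\<^sup>2\<close>, which does not vary with the first argument;
  \<open>k = 0\<close> covers the unperturbed objective.\<close>

lemma grad_inner_diff: "grad (\<lambda>u. g \<bullet> u - k) x = g"
  by (rule grad_eqI) (auto simp: gderiv_def inner_commute intro!: derivative_eq_intros)

lemma grad_x_linear: "grad_x (\<lambda>x y. g \<bullet> x) x y = g"
  using grad_inner_diff[of g 0] by (simp add: grad_x_def)

lemma grad_y_linear: "grad_y (\<lambda>x y. g \<bullet> x) x y = 0"
  unfolding grad_y_def by (rule grad_eqI) (simp add: gderiv_def)

lemma grad_x_perturbed_linear: "grad_x (perturbed r (\<lambda>x y. g \<bullet> x)) x y = g"
  by (simp add: grad_x_def perturbed_def grad_inner_diff)

section \<open>Admissibility and initial gap of the instance\<close>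

text \<open>Both partial gradients are constant, so the Lipschitz bounds have left-hand side 0 and
  hold for every positive \<open>l\<close>.\<close>

lemma minimax_problem_linear:
  fixes g :: "'a::euclidean_space" and Y :: "'b::euclidean_space set"
  assumes "0 < l" "X \<noteq> {}" "closed X" "convex X"
    and "compact Y" "convex Y" "0 \<in> Y" "0 < diameter Y"
  shows "minimax_problem l (\<lambda>x y. g \<bullet> x) X Y"
proof -
  \<comment> \<open>A bounded linear map is its own derivative at every point, so one constant field
    \<open>f'\<close> witnesses continuous differentiability.\<close>
  define f' :: "('a \<times> 'b) \<Rightarrow>\<^sub>L real" where "f' = Blinfun (\<lambda>p. g \<bullet> fst p)"
  have lin: "bounded_linear (\<lambda>p :: 'a \<times> 'b. g \<bullet> fst p)"
    by (intro bounded_linear_intros)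
  then have "blinfun_apply f' = (\<lambda>p. g \<bullet> fst p)"
    by (simp add: f'_def bounded_linear_Blinfun_apply)
  then have "((\<lambda>(x, y). g \<bullet> x) has_derivative blinfun_apply f') (at p)" for p :: "'a \<times> 'b"
    using bounded_linear_imp_has_derivative[OF lin] by (simp add: case_prod_unfold)
  then have "continuously_differentiable (\<lambda>x (y :: 'b). g \<bullet> x)"
    unfolding continuously_differentiable_def
    by (intro exI[of _ "\<lambda>_. f'"]) auto
  moreover have "smooth_on_domain l (\<lambda>x (y :: 'b). g \<bullet> x) X Y"
    using assms(1) by (simp add: smooth_on_domain_def grad_x_linear grad_y_linear)
  moreover have "concave_on Y (\<lambda>y. g \<bullet> x)" for x
    using assms(6) by (simp add: concave_on_def convex_on_const)
  ultimately show ?thesis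
    using assms by (auto simp: minimax_problem_def)
qed

text \<open>The perturbation only subtracts a nonnegative term that vanishes at
  \<open>y = 0\<close>, where the maximum is therefore attained. As the result is free of
  \<open>r\<close>, one instance can serve both perturbation sizes.\<close>

lemma max_fun_perturbed_linear:
  assumes "0 \<in> Y" "0 \<le> r"
  shows "max_fun (perturbed r (\<lambda>x y. g \<bullet> x)) Y x = g \<bullet> x"
  unfolding max_fun_def
proof (rule cSup_eq_maximum)
  show "g \<bullet> x \<in> perturbed r (\<lambda>x y. g \<bullet> x) x ` Y"
    using assms(1) by (intro image_eqI[of _ _ 0]) (auto simp: perturbed_def)
qed (use assms(2) in \<open>auto simp: perturbed_def\<close>)

text \<open>The minimum over the half-space is 0, attained at the origin, and starting at
  \<open>y = 0\<close> gives \<open>Psi\<close> the value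
  \<open>2 * (g \<bullet> x0) - g \<bullet> x0\<close>.\<close>

lemma has_initial_gap_halfspace:
  assumes "0 \<in> Y" "0 \<le> r"
  shows "has_initial_gap r (\<lambda>x y. g \<bullet> x) {x. 0 \<le> g \<bullet> x} Y x0 0 (g \<bullet> x0)"
  using assms unfolding has_initial_gap_def
  by (intro bexI[of _ 0]) (auto simp: max_fun_perturbed_linear Psi_def perturbed_def)

section \<open>Speed of descent\<close>

text \<open>Whatever the dual iterate is, the gradient step moves \<open>x\<close> by
  \<open>- c *\<^sub>R g\<close> and so lowers \<open>g \<bullet> x\<close> by exactly
  \<open>c * (norm g)\<^sup>2\<close>; the projection never lowers it further.\<close>

lemma perturbed_gda_halfspace_decrease:
  fixes g :: "'a::euclidean_space" and Y :: "'b::euclidean_space set"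
  shows "g \<bullet> x0 - real t * (c * (norm g)\<^sup>2)
    \<le> g \<bullet> fst (perturbed_gda r \<alpha> c (\<lambda>x y. g \<bullet> x) {x. 0 \<le> g \<bullet> x} Y x0 y0 t)"
proof (induction t)
  case (Suc t)
  let ?X = "{x. 0 \<le> g \<bullet> x}"
  obtain x y where xy: "perturbed_gda r \<alpha> c (\<lambda>x y. g \<bullet> x) ?X Y x0 y0 t = (x, y)"
    by fastforce
  have "g \<bullet> (x - c *\<^sub>R g) \<le> g \<bullet> closest_point ?X (x - c *\<^sub>R g)"
  \<comment> \<open>Outside the half-space the value is negative, while the projected point has a
    nonnegative one; inside, the projection is the identity.\<close>
  proof (cases "x - c *\<^sub>R g \<in> ?X")
    case False
    have "closed ?X" "?X \<noteq> {}"
      by (auto simp: closed_halfspace_ge intro: exI[of _ 0])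
    then have "closest_point ?X (x - c *\<^sub>R g) \<in> ?X"
      by (rule closest_point_in_set)
    with False show ?thesis
      by simp
  qed (simp add: closest_point_self)
  with Suc show ?case
    by (simp add: xy Let_def grad_x_perturbed_linear power2_norm_eq_inner
        algebra_simps)
qed simp

section \<open>Game stationarity\<close>

lemma subdifferential_ind_fun_interior:
  assumes "x \<in> interior S"
  shows "subdifferential (ind_fun S) x = {0}"
proof -
  from assms have "x \<in> S"
    using interior_subset by blast
  have "v = 0" if v: "v \<in> subdifferential (ind_fun S) x" for v
  proof (rule ccontr)
    assume "v \<noteq> 0"
    obtain e where e: "0 < e" "cball x e \<subseteq> S"
      using assms by (auto simp: mem_interior_cball)
    \<comment> \<open>The subgradient inequality is tested at a step of length \<open>e\<close> in
      the direction of \<open>v\<close> itself, where the linear term equals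
      \<open>e * norm v\<close>.\<close>
    define z where "z = x + (e / norm v) *\<^sub>R v"
    have "z \<in> S"
      using e \<open>v \<noteq> 0\<close> by (intro subsetD[OF e(2)]) (simp add: z_def dist_norm)
    moreover have "ind_fun S x + ereal (v \<bullet> (z - x)) \<le> ind_fun S z"
      using v by (simp add: subdifferential_def)
    ultimately have "v \<bullet> (z - x) \<le> 0"
      using \<open>x \<in> S\<close> by (simp add: ind_fun_def)
    moreover have "v \<bullet> (z - x) = e * norm v"
      using \<open>v \<noteq> 0\<close> by (simp add: z_def power2_eq_square flip: power2_norm_eq_inner)
    moreover have "0 < e * norm v"
      using e \<open>v \<noteq> 0\<close> by simp
    ultimately show False
      by simp
  qed
  moreover have "0 \<in> subdifferential (ind_fun S) x"
    using \<open>x \<in> S\<close> by (simp add: subdifferential_def ind_fun_def)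
  ultimately show ?thesis
    by blast
qed

text \<open>In the interior the normal cone is trivial, so the shifted set is \<open>{g}\<close>, at
  distance \<open>norm g\<close> from 0.\<close>

lemma game_stationary_halfspace:
  assumes "game_stationary \<epsilon> (\<lambda>x y. g \<bullet> x) {x. 0 \<le> g \<bullet> x} Y x y" and "\<epsilon> < norm g"
  shows "g \<bullet> x \<le> 0"
proof (rule ccontr)
  assume "\<not> g \<bullet> x \<le> 0"
  then have "x \<in> interior {x. 0 \<le> g \<bullet> x}"
    by (subst interior_halfspace_ge) auto
  then have "subdifferential (ind_fun {x. 0 \<le> g \<bullet> x}) x = {0}"
    by (rule subdifferential_ind_fun_interior)
  with assms show False
    by (simp add: game_stationary_def grad_x_linear)
qed

section \<open>Optimization stationarity\<close>

text \<open>The proximal objective is a quadratic on the half-space, and \<open>in_dom\<close> says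
  exactly that its unconstrained minimizer is feasible.\<close>

lemma prox_halfspace:
  fixes g x :: "'a::euclidean_space"
  assumes "0 < l" "Y \<noteq> {}" and in_dom: "(norm g)\<^sup>2 / (2 * l) \<le> g \<bullet> x"
  shows "prox (1 / (2 * l)) (Phi (\<lambda>x y. g \<bullet> x) {x. 0 \<le> g \<bullet> x} Y) x = x - (1 / (2 * l)) *\<^sub>R g"
proof -
  define p where "p = x - (1 / (2 * l)) *\<^sub>R g"
  define obj where "obj w = Phi (\<lambda>x y. g \<bullet> x) {x. 0 \<le> g \<bullet> x} Y w
      + ereal (1 / (2 * (1 / (2 * l))) * (norm (w - x))\<^sup>2)" for w
  \<comment> \<open>Completing the square around \<open>p\<close> leaves the excess
    \<open>l * (norm (w - p))\<^sup>2\<close> over the value at \<open>p\<close>.\<close>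
  have square: "g \<bullet> w + l * (norm (w - x))\<^sup>2 = g \<bullet> p + l * (norm (p - x))\<^sup>2 + l * (norm (w - p))\<^sup>2" for w
  proof -
    define d where "d = w - x"
    have "g \<bullet> w = g \<bullet> x + g \<bullet> d"
      by (simp add: d_def inner_diff_right)
    moreover have "w - p = d + (1 / (2 * l)) *\<^sub>R g" "norm (p - x) = norm ((1 / (2 * l)) *\<^sub>R g)"
      by (simp_all add: d_def p_def)
    moreover have "(norm (d + (1 / (2 * l)) *\<^sub>R g))\<^sup>2
        = (norm d)\<^sup>2 + (g \<bullet> d) / l + (norm ((1 / (2 * l)) *\<^sub>R g))\<^sup>2"
      by (simp add: power2_norm_eq_inner inner_add_left inner_add_right inner_commute[of d g]
          add_divide_distrib del: norm_scaleR)
    moreover have "g \<bullet> p = g \<bullet> x - 2 * l * (norm ((1 / (2 * l)) *\<^sub>R g))\<^sup>2"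
      using assms(1)
      by (simp add: p_def inner_diff_right power_divide power2_eq_square
          flip: power2_norm_eq_inner)
    ultimately show ?thesis
      using assms(1) by (simp only: d_def[symmetric]) (simp add: distrib_left del: norm_scaleR)
  qed
  have obj_in: "obj w = ereal (g \<bullet> w + l * (norm (w - x))\<^sup>2)" if "0 \<le> g \<bullet> w" for w
    using that assms(2) by (simp add: obj_def Phi_def ind_fun_def max_fun_def)
  have obj_out: "obj w = \<infinity>" if "\<not> 0 \<le> g \<bullet> w" for w
    using that by (simp add: obj_def Phi_def ind_fun_def)
  have p_in: "0 \<le> g \<bullet> p"
    using in_dom by (simp add: p_def inner_diff_right power2_norm_eq_inner)
  \<comment> \<open>Strictness matters: \<open>arg_min\<close> chooses an arbitrary minimizer, so
    \<open>p\<close> has to be the only one.\<close>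
  have less: "obj p < obj w" if "w \<noteq> p" for w
  proof (cases "0 \<le> g \<bullet> w")
    case True
    then show ?thesis
      using that assms(1) by (simp add: obj_in p_in square[of w])
  qed (simp add: obj_in p_in obj_out)
  have "arg_min obj (\<lambda>_. True) = p"
    unfolding arg_min_def is_arg_min_def
  proof (rule some_equality)
    show "True \<and> \<not> (\<exists>w. True \<and> obj w < obj p)"
      using less less_asym by blast
    fix w assume "True \<and> \<not> (\<exists>w'. True \<and> obj w' < obj w)"
    then show "w = p"
      using less by blast
  qed
  then show ?thesis
    by (simp add: prox_def obj_def[abs_def] p_def)
qed

text \<open>Beyond this boundary layer the proximal step is
  \<open>- (1 / (2 * l)) *\<^sub>R g\<close>, whose length \<open>norm g / (2 * l)\<close> exceeds
  \<open>\<epsilon> / (2 * l)\<close>.\<close>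

lemma optimization_stationary_halfspace:
  assumes "optimization_stationary l \<epsilon> (\<lambda>x y. g \<bullet> x) {x. 0 \<le> g \<bullet> x} Y x"
    and "0 < l" "Y \<noteq> {}" "\<epsilon> < norm g"
  shows "g \<bullet> x < (norm g)\<^sup>2 / (2 * l)"
proof (rule ccontr)
  assume "\<not> ?thesis"
  then have "norm g / (2 * l) \<le> \<epsilon> / (2 * l)"
    using assms prox_halfspace[of l Y g x] by (simp add: optimization_stationary_def)
  then show False
    using assms(2,4) by (simp add: divide_le_cancel)
qed

section \<open>From step sizes to rates\<close>

text \<open>One factor \<open>b\<close> comes from the upper bound on \<open>c\<close>, and two more
  from squaring \<open>r \<le> b * v\<close>.\<close>

lemma gda_parameters_step_le:
  assumes "gda_parameters a b l r \<alpha> c" "theta_rel a b r v" "0 < l" "0 < b"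
  shows "c \<le> b ^ 3 * v\<^sup>2 / l ^ 3"
proof -
  have "r\<^sup>2 \<le> (b * v)\<^sup>2"
    using assms by (intro power_mono) (auto simp: gda_parameters_def theta_rel_def)
  then have "b * (r\<^sup>2 / l ^ 3) \<le> b * ((b * v)\<^sup>2 / l ^ 3)"
    using assms by (intro mult_left_mono divide_right_mono) auto
  then show ?thesis
    using assms(1)
    by (auto simp: gda_parameters_def theta_rel_def power_mult_distrib power2_eq_square
        power3_eq_cube mult_ac)
qed

text \<open>Here \<open>s\<close> is the scale of the step size. The constant 8 is the 2 of
  \<open>\<Delta> / 2\<close> times the 4 of \<open>(2 * \<epsilon>)\<^sup>2\<close>.\<close>

lemma iterations_ge:
  assumes "\<Delta> / 2 \<le> real T * (c * (2 * \<epsilon>)\<^sup>2)" "c \<le> b ^ 3 * s" "0 < s" "0 < \<epsilon>" "0 < b"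
  shows "1 / (8 * b ^ 3) * (\<Delta> / (s * \<epsilon>\<^sup>2)) \<le> real T"
proof -
  have "real T * (c * (2 * \<epsilon>)\<^sup>2) \<le> real T * ((b ^ 3 * s) * (2 * \<epsilon>)\<^sup>2)"
    using assms(2) by (intro mult_left_mono mult_right_mono) auto
  with assms(1) have "\<Delta> \<le> real T * (8 * b ^ 3 * s * \<epsilon>\<^sup>2)"
    by (simp add: algebra_simps)
  then show ?thesis
    using assms(3-5) by (simp add: pos_divide_le_eq mult_ac)
qed

text \<open>Quantifying \<open>K\<close> first keeps the hidden constant independent of the problem
  data, whereas the threshold \<open>\<epsilon>0\<close> may depend on them.\<close>

theorem theorem3p2:
  fixes a b :: real
  assumes "0 < a" and "0 < b"
  shows "\<exists>K>0. \<forall>l>0. \<forall>D>0. \<forall>\<Delta>>0. \<exists>\<epsilon>0>0. \<forall>\<epsilon>. 0 < \<epsilon> \<and> \<epsilon> < 1 \<and> \<epsilon> < \<epsilon>0 \<longrightarrow>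
    (\<forall>r1 \<alpha>1 c1 r2 \<alpha>2 c2.
      gda_parameters a b l r1 \<alpha>1 c1 \<and> theta_rel a b r1 (\<epsilon> / D) \<and>
      gda_parameters a b l r2 \<alpha>2 c2 \<and> theta_rel a b r2 (\<epsilon>\<^sup>2 / (l * D\<^sup>2)) \<longrightarrow>
      (\<exists>(f :: real^'n \<Rightarrow> real^'d \<Rightarrow> real) X Y x0 y0.
        minimax_problem l f X Y \<and> diameter Y = D \<and> x0 \<in> X \<and> y0 \<in> Y \<and>
        has_initial_gap r1 f X Y x0 y0 \<Delta> \<and> has_initial_gap r2 f X Y x0 y0 \<Delta> \<and>
        (\<forall>T xT yT.
          (xT, yT) = perturbed_gda r1 \<alpha>1 c1 f X Y x0 y0 T \<and> game_stationary \<epsilon> f X Y xT yT \<longrightarrow>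
          real T \<ge> K * (l ^ 3 * D\<^sup>2 * \<Delta> / \<epsilon> ^ 4)) \<and>
        (\<forall>T xT yT.
          (xT, yT) = perturbed_gda r2 \<alpha>2 c2 f X Y x0 y0 T \<and>
          optimization_stationary l \<epsilon> f X Y xT \<longrightarrow>
          real T \<ge> K * (l ^ 5 * D ^ 4 * \<Delta> / \<epsilon> ^ 6))))"
proof -
  let ?K = "1 / (8 * b ^ 3)"
  have main: "\<exists>(f :: real^'n \<Rightarrow> real^'d \<Rightarrow> real) X Y x0 y0.
        minimax_problem l f X Y \<and> diameter Y = D \<and> x0 \<in> X \<and> y0 \<in> Y \<and>
        has_initial_gap r1 f X Y x0 y0 \<Delta> \<and> has_initial_gap r2 f X Y x0 y0 \<Delta> \<and>
        (\<forall>T xT yT.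
          (xT, yT) = perturbed_gda r1 \<alpha>1 c1 f X Y x0 y0 T \<and> game_stationary \<epsilon> f X Y xT yT \<longrightarrow>
          real T \<ge> ?K * (l ^ 3 * D\<^sup>2 * \<Delta> / \<epsilon> ^ 4)) \<and>
        (\<forall>T xT yT.
          (xT, yT) = perturbed_gda r2 \<alpha>2 c2 f X Y x0 y0 T \<and>
          optimization_stationary l \<epsilon> f X Y xT \<longrightarrow>
          real T \<ge> ?K * (l ^ 5 * D ^ 4 * \<Delta> / \<epsilon> ^ 6))"
    if pos: "0 < l" "0 < D" "0 < \<Delta>" and eps: "0 < \<epsilon>" "\<epsilon> < 1" "\<epsilon> < l * \<Delta> / 4"
      and par1: "gda_parameters a b l r1 \<alpha>1 c1" "theta_rel a b r1 (\<epsilon> / D)"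
      and par2: "gda_parameters a b l r2 \<alpha>2 c2" "theta_rel a b r2 (\<epsilon>\<^sup>2 / (l * D\<^sup>2))"
    for l D \<Delta> \<epsilon> r1 \<alpha>1 c1 r2 \<alpha>2 c2
  proof -
    \<comment> \<open>The slope must exceed \<open>\<epsilon>\<close> to rule out stationarity in
      the interior, yet be of order \<open>\<epsilon>\<close> to keep the descent slow.\<close>
    obtain g :: "real^'n" where g: "norm g = 2 * \<epsilon>"
      using vector_choose_size[of "2 * \<epsilon>"] eps(1) by auto
    define f :: "real^'n \<Rightarrow> real^'d \<Rightarrow> real" where "f = (\<lambda>x y. g \<bullet> x)"
    define X where "X = {x. 0 \<le> g \<bullet> x}"
    define Y :: "(real^'d) set" where "Y = cball 0 (D / 2)"
    \<comment> \<open>This multiple of \<open>g\<close> places the start at height exactly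
      \<open>\<Delta>\<close>, the prescribed gap.\<close>
    define x0 where "x0 = (\<Delta> / (norm g)\<^sup>2) *\<^sub>R g"
    have gap: "g \<bullet> x0 = \<Delta>"
      using g eps(1) by (simp add: x0_def flip: power2_norm_eq_inner)
    have Y: "0 \<in> Y" "compact Y" "convex Y" "diameter Y = D"
      using pos by (auto simp: Y_def)
    have "minimax_problem l f X Y"
      unfolding f_def using pos Y
      by (intro minimax_problem_linear)
        (auto simp: X_def closed_halfspace_ge convex_halfspace_ge intro: exI[of _ 0])
    moreover have "x0 \<in> X"
      using gap pos by (simp add: X_def)
    moreover have "has_initial_gap r f X Y x0 0 \<Delta>" if "0 < r" for r
      using has_initial_gap_halfspace[of Y r g x0] that Y gap by (simp add: f_def X_def)
    then have "has_initial_gap r1 f X Y x0 0 \<Delta>" "has_initial_gap r2 f X Y x0 0 \<Delta>"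
      using par1(1) par2(1) by (auto simp: gda_parameters_def)
    moreover have decrease: "\<Delta> - real T * (c * (2 * \<epsilon>)\<^sup>2) \<le> g \<bullet> xT"
      if "(xT, yT) = perturbed_gda r \<alpha> c f X Y x0 0 T" for T xT yT r \<alpha> c
      using perturbed_gda_halfspace_decrease[of g x0 T c r \<alpha> Y 0] that[symmetric] g gap
      by (simp add: f_def X_def)
    have "real T \<ge> ?K * (l ^ 3 * D\<^sup>2 * \<Delta> / \<epsilon> ^ 4)"
      if run: "(xT, yT) = perturbed_gda r1 \<alpha>1 c1 f X Y x0 0 T"
        and stat: "game_stationary \<epsilon> f X Y xT yT" for T xT yT
    proof -
      have "g \<bullet> xT \<le> 0"
        using stat g eps(1) unfolding f_def X_def by (intro game_stationary_halfspace) auto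
      \<comment> \<open>Half of the available drop suffices and lets both items share
        \<open>iterations_ge\<close>.\<close>
      then have "\<Delta> / 2 \<le> real T * (c1 * (2 * \<epsilon>)\<^sup>2)"
        using decrease[OF run] pos by linarith
      moreover have "c1 \<le> b ^ 3 * (\<epsilon>\<^sup>2 / (l ^ 3 * D\<^sup>2))"
        using gda_parameters_step_le[OF par1 pos(1) assms(2)] by (simp add: power_divide mult_ac)
      ultimately have "?K * (\<Delta> / (\<epsilon>\<^sup>2 / (l ^ 3 * D\<^sup>2) * \<epsilon>\<^sup>2)) \<le> real T"
        by (rule iterations_ge) (use pos eps assms in auto)
      moreover have "\<Delta> / (\<epsilon>\<^sup>2 / (l ^ 3 * D\<^sup>2) * \<epsilon>\<^sup>2) = l ^ 3 * D\<^sup>2 * \<Delta> / \<epsilon> ^ 4"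
        by (simp add: power2_eq_square eval_nat_numeral mult_ac)
      ultimately show ?thesis
        by (simp only:)
    qed
    moreover have "real T \<ge> ?K * (l ^ 5 * D ^ 4 * \<Delta> / \<epsilon> ^ 6)"
      if run: "(xT, yT) = perturbed_gda r2 \<alpha>2 c2 f X Y x0 0 T"
        and stat: "optimization_stationary l \<epsilon> f X Y xT" for T xT yT
    proof -
      \<comment> \<open>The threshold \<open>l * \<Delta> / 4\<close> originates here: it confines
        the boundary layer, of height \<open>2 * \<epsilon>\<^sup>2 / l\<close>, to the lower half
        of the initial height.\<close>
      have "\<epsilon>\<^sup>2 \<le> l * \<Delta> / 4"
        using eps power_decreasing[of 1 2 \<epsilon>] by simp
      then have "(norm g)\<^sup>2 / (2 * l) \<le> \<Delta> / 2"
        using pos(1) g by (simp add: field_simps)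
      moreover have "g \<bullet> xT < (norm g)\<^sup>2 / (2 * l)"
        using stat pos(1) Y(1) g eps(1) unfolding f_def X_def
        by (intro optimization_stationary_halfspace[of l \<epsilon> g Y]) auto
      ultimately have "\<Delta> / 2 \<le> real T * (c2 * (2 * \<epsilon>)\<^sup>2)"
        using decrease[OF run] by linarith
      moreover have "c2 \<le> b ^ 3 * (\<epsilon> ^ 4 / (l ^ 5 * D ^ 4))"
        using gda_parameters_step_le[OF par2 pos(1) assms(2)]
        by (simp add: power_divide power_mult_distrib eval_nat_numeral mult_ac)
      ultimately have "?K * (\<Delta> / (\<epsilon> ^ 4 / (l ^ 5 * D ^ 4) * \<epsilon>\<^sup>2)) \<le> real T"
        by (rule iterations_ge) (use pos eps assms in auto)
      moreover have "\<Delta> / (\<epsilon> ^ 4 / (l ^ 5 * D ^ 4) * \<epsilon>\<^sup>2) = l ^ 5 * D ^ 4 * \<Delta> / \<epsilon> ^ 6"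
        by (simp add: power2_eq_square eval_nat_numeral mult_ac)
      ultimately show ?thesis
        by (simp only:)
    qed
    ultimately show ?thesis
      using Y by blast
  qed
  show ?thesis
  proof (rule exI[of _ ?K], rule conjI)
    show "0 < ?K"
      using assms by simp
  \<comment> \<open>The pattern stands for \<open>\<epsilon>0 = l * \<Delta> / 4\<close>; its
    factors are determined by the smallness premise of \<open>main\<close>.\<close>
  qed (intro allI impI exI[of _ "_ * _ / 4"] conjI main; (elim conjE; assumption)?; simp)
qed

end
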